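(* Let $H$ be a finite dimensional Hilbert space and let $(x_j)_{j\in J}$ be a frame of $H$ with frame bounds $B\geq A>0$ which does $C$-stable phase retrieval. Let $\varepsilon>0$ satisfy $\varepsilon<2^{-4}C^{-4}B^{-1}$ and let $(y_j)_{j\in J}\subseteq H$ be such that $\sum_{j\in J}\|x_j-y_j\|^2<\varepsilon$. Then $(y_j)_{j\in J}$ is a frame of $H$ with upper frame bound $B\left(1+\sqrt{\frac{\varepsilon}{B}}\right)^2$ and lower frame bound $A\left(1-\sqrt{\frac{\varepsilon}{A}}\right)^2$, and $(y_j)_{j\in J}$ does $C\left(1-4C^2\sqrt{\varepsilon B}\right)^{-1/2}$-stable phase retrieval for $H$.
   Context: A collection of vectors $(x_j)_{j\in J}$ in a Hilbert space $H$ is a frame of $H$ with (lower and upper) frame bounds $B\geq A>0$ if $A\|x\|^2\leq\sum_{j\in J}|\langle x,x_j\rangle|^2\leq B\|x\|^2$ for all $x\in H$; the bounds are not required to be optimal. For a constant $C>0$, a frame $(x_j)_{j\in J}$ of $H$ does $C$-stable phase retrieval (for $H$) if for all $x,y\in H$, $$\min_{|\lambda|=1}\|x-\lambda y\|\leq C\Big(\sum_{j\in J}\big||\langle x,x_j\rangle|-|\langle y,x_j\rangle|\big|^2\Big)^{1/2},$$ where the minimum is over scalars $\lambda$ with $|\lambda|=1$.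
   Formalization: The lower frame bound A(1−√(ε/A))² is not claimed to be positive: it is 0 when ε = A, which the hypotheses allow; instead the frame inequality is shown with the stated bounds, and (y_j) is shown to be a frame with some positive bounds. *)

theory Defs
  imports "HOL-Analysis.Analysis"
begin

text \<open>
  Hilbert spaces are taken over \<open>\<real>\<close> or \<open>\<complex>\<close>; the library has no common
  abstraction of the two scalar fields.  The class below provides it: \<open>real\<close> and \<open>complex\<close> are
  instances, and lemma \<open>rc_scalar_real_or_complex\<close> shows that there are no others up to isomorphism.
\<close>

class rc_scalar = real_normed_field +
  fixes conj :: "'a \<Rightarrow> 'a"
    and re :: "'a \<Rightarrow> real"
  assumes conj_add: "conj (z + w) = conj z + conj w"
    and conj_mult: "conj (z * w) = conj z * conj w"
    and mult_conj_scaleR: "z * conj z = (norm z)\<^sup>2 *\<^sub>R 1"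
    and add_conj_scaleR: "z + conj z = (2 * re z) *\<^sub>R 1"

lemma mult_conj: "z * conj z = (of_real ((norm z)\<^sup>2) :: 'a::rc_scalar)"
  by (simp only: mult_conj_scaleR of_real_def)

lemma add_conj: "z + conj z = (of_real (2 * re z) :: 'a::rc_scalar)"
  by (simp only: add_conj_scaleR of_real_def)

instantiation real :: rc_scalar
begin

definition conj_real :: "real \<Rightarrow> real" where "conj_real z = z"
definition re_real :: "real \<Rightarrow> real" where "re_real z = z"

instance
  by standard (simp_all add: conj_real_def re_real_def power2_eq_square)

end

instantiation complex :: rc_scalar
begin

definition conj_complex :: "complex \<Rightarrow> complex" where "conj_complex = cnj"
definition re_complex :: "complex \<Rightarrow> real" where "re_complex = Re"

instance
proof
  fix z w :: complex
  show "conj (z + w) = conj z + conj w" "conj (z * w) = conj z * conj w"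
    by (simp_all add: conj_complex_def)
  show "z * conj z = (norm z)\<^sup>2 *\<^sub>R 1"
    by (simp add: conj_complex_def scaleR_conv_of_real complex_norm_square[symmetric])
  show "z + conj z = (2 * re z) *\<^sub>R 1"
    by (simp add: conj_complex_def re_complex_def scaleR_conv_of_real complex_add_cnj)
qed

end

lemma conj_of_real: "conj (of_real r :: 'a::rc_scalar) = of_real r"
proof (cases "r = 0")
  case True
  have "conj (0 + 0 :: 'a) = conj 0 + conj 0" by (rule conj_add)
  then show ?thesis using True by simp
next
  case False
  have "of_real r * conj (of_real r :: 'a) = of_real r * of_real r"
    by (simp add: mult_conj power2_eq_square flip: of_real_mult)
  then show ?thesis using False by simp
qed

lemma rc_scalar_real_or_complex:
  "(\<forall>z::'a::rc_scalar. \<exists>a. z = of_real a) \<or>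
   (\<exists>i::'a. i * i = -1 \<and> (\<forall>z. \<exists>!(a, b). z = of_real a + of_real b * i))"
proof (cases "\<forall>z::'a. conj z = z")
  case True
  have "z = of_real (re z)" for z :: 'a
    using add_conj[of z] True by simp
  then show ?thesis by blast
next
  case False
  then obtain z :: 'a where z: "conj z \<noteq> z" by blast
  have c0: "conj (0::'a) = 0" using conj_of_real[of 0] by simp
  have cminus: "conj (- u) = - conj u" for u :: 'a
    using conj_add[of u "-u"] by (simp add: c0 eq_neg_iff_add_eq_0 add.commute)
  have cdiff: "conj (u - v) = conj u - conj v" for u v :: 'a
    using conj_add[of u "-v"] by (simp add: cminus)
  have cc: "conj (conj u) = u" for u :: 'a
  proof -
    have "conj u = of_real (2 * re u) - u"
      using add_conj[of u] by (simp add: algebra_simps)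
    then show ?thesis by (simp only: cdiff conj_of_real) simp
  qed
  define w where "w = z - conj z"
  have w0: "w \<noteq> 0" and cw: "conj w = - w" using z by (auto simp: w_def cdiff cc)
  define i where "i = w / of_real (norm w)"
  have i_eq: "i = of_real (inverse (norm w)) * w"
    by (simp add: i_def divide_inverse mult.commute of_real_inverse)
  have ci: "conj i = - i" unfolding i_eq by (simp only: conj_mult conj_of_real cw) simp
  have ni: "norm i = 1" using w0 by (simp add: i_def norm_divide)
  have ii: "i * i = -1" using mult_conj[of i] by (simp add: ci ni minus_equation_iff)
  have "\<exists>!(a, b). u = of_real a + of_real b * i" for u :: 'a
  proof -
    define v where "v = - (u - of_real (re u)) * i"
    have cu: "conj u = of_real (2 * re u) - u" using add_conj[of u] by (simp add: algebra_simps)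
    have "conj v = v"
      by (simp add: v_def conj_mult cminus cdiff conj_of_real ci cu algebra_simps)
    then have v: "v = of_real (re v)" using add_conj[of v] by simp
    have "v * i = u - of_real (re u)" by (simp add: v_def ii mult.assoc)
    then have ex: "u = of_real (re u) + of_real (re v) * i" using v by simp
    have uni: "a = a' \<and> b = b'"
      if eq: "of_real a + of_real b * i = of_real a' + of_real b' * i" for a b a' b'
    proof -
      have "conj (of_real a + of_real b * i) = conj (of_real a' + of_real b' * i)"
        using eq by simp
      then have eq2: "of_real a - of_real b * i = of_real a' - of_real b' * i"
        by (simp add: conj_add conj_mult conj_of_real ci)
      have "(of_real a + of_real b * i) + (of_real a - of_real b * i)
          = (of_real a' + of_real b' * i) + (of_real a' - of_real b' * i)"
        using eq eq2 by simp
      then have a: "a = a'" by simp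
      have "i \<noteq> 0" using ni by auto
      then show ?thesis using eq a by simp
    qed
    show ?thesis
    proof (rule ex1I[of _ "(re u, re v)"])
      show "case (re u, re v) of (a, b) \<Rightarrow> u = of_real a + of_real b * i" using ex by simp
    next
      fix p :: "real \<times> real"
      assume "case p of (a, b) \<Rightarrow> u = of_real a + of_real b * i"
      then have "of_real (fst p) + of_real (snd p) * i = of_real (re u) + of_real (re v) * i"
        using ex by (simp add: case_prod_beta)
      then show "p = (re u, re v)" using uni by (simp add: prod_eq_iff)
    qed
  qed
  then show ?thesis using ii by blast
qed


text \<open>Completeness is not assumed, as it is automatic in finite dimension.\<close>

locale fd_hilbert_space = vector_space scale
  for scale :: "'k::rc_scalar \<Rightarrow> 'h::ab_group_add \<Rightarrow> 'h" +
  fixes ip :: "'h \<Rightarrow> 'h \<Rightarrow> 'k"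
  assumes ip_add_left: "ip (x + y) z = ip x z + ip y z"
    and ip_scale_left: "ip (scale a x) z = a * ip x z"
    and ip_commute: "ip x y = conj (ip y x)"
    and ip_pos: "x \<noteq> 0 \<Longrightarrow> 0 < re (ip x x)"
    and finite_dimensional: "\<exists>S. finite S \<and> span S = UNIV"
begin

definition hnorm :: "'h \<Rightarrow> real" where
  "hnorm x = sqrt (re (ip x x))"

text \<open>
  \<open>frame_inequality\<close> does not require the bounds to be positive, since the lower bound
  \<open>A * (1 - sqrt (\<epsilon> / A))\<^sup>2\<close> of the perturbed frame vanishes for \<open>\<epsilon> = A\<close> (possible because
  \<open>A\<close> need not be optimal); that some positive lower bound exists is part of \<open>is_frame\<close>.
  The index set may be infinite.  Summability is stated explicitly because \<open>infsum\<close> is \<open>0\<close> on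
  families that are not summable.
\<close>

definition frame_inequality :: "'j set \<Rightarrow> ('j \<Rightarrow> 'h) \<Rightarrow> real \<Rightarrow> real \<Rightarrow> bool" where
  "frame_inequality J x A B \<longleftrightarrow>
     (\<forall>h. (\<lambda>j. (norm (ip h (x j)))\<^sup>2) summable_on J \<and>
          A * (hnorm h)\<^sup>2 \<le> (\<Sum>\<^sub>\<infinity>j\<in>J. (norm (ip h (x j)))\<^sup>2) \<and>
          (\<Sum>\<^sub>\<infinity>j\<in>J. (norm (ip h (x j)))\<^sup>2) \<le> B * (hnorm h)\<^sup>2)"

definition is_frame :: "'j set \<Rightarrow> ('j \<Rightarrow> 'h) \<Rightarrow> bool" where
  "is_frame J x \<longleftrightarrow> (\<exists>A B. 0 < A \<and> A \<le> B \<and> frame_inequality J x A B)"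

text \<open>
  The infimum over the compact set of unimodular scalars is a minimum.  The sum on the right
  converges because \<open>x\<close> is a frame.
\<close>

definition stable_phase_retrieval :: "real \<Rightarrow> 'j set \<Rightarrow> ('j \<Rightarrow> 'h) \<Rightarrow> bool" where
  "stable_phase_retrieval C J x \<longleftrightarrow>
     0 < C \<and> is_frame J x \<and>
     (\<forall>f g. (INF l\<in>{l::'k. norm l = 1}. hnorm (f - scale l g))
            \<le> C * sqrt (\<Sum>\<^sub>\<infinity>j\<in>J. \<bar>norm (ip f (x j)) - norm (ip g (x j))\<bar>\<^sup>2))"

end


text \<open>The library's real inner product spaces, and \<open>\<complex>\<^sup>n\<close>, are covered:\<close>

lemma fd_hilbert_space_real_inner:
  assumes "\<exists>S. finite S \<and> span S = (UNIV :: 'a::real_inner set)"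
  shows "fd_hilbert_space (scaleR :: real \<Rightarrow> 'a \<Rightarrow> 'a) inner"
  using assms
  by unfold_locales
    (auto simp: inner_add_left conj_real_def re_real_def inner_commute span_raw_def algebra_simps)

lemma fd_hilbert_space_complex_vec:
  "fd_hilbert_space (vector_scalar_mult :: complex \<Rightarrow> complex ^ 'n \<Rightarrow> complex ^ 'n)
     (\<lambda>x y. \<Sum>i\<in>UNIV. x $ i * cnj (y $ i))"
proof -
  have "re (\<Sum>i\<in>UNIV. x $ i * cnj (x $ i)) > 0" if nz: "x \<noteq> 0" for x :: "complex ^ 'n"
  proof -
    obtain i where "x $ i \<noteq> 0" using nz by (metis vec_eq_iff zero_index)
    then have "0 < (\<Sum>i\<in>UNIV. (norm (x $ i))\<^sup>2)"
      by (intro sum_pos2[of _ i]) auto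
    then show ?thesis
      by (simp add: re_complex_def flip: complex_norm_square of_real_sum of_real_power)
  qed
  moreover have "\<exists>S::(complex ^ 'n) set. finite S \<and> vec.span S = UNIV"
    using vec.span_Basis finite_cart_basis by blast
  ultimately show ?thesis
    by unfold_locales
      (auto simp: sum.distrib sum_distrib_left conj_complex_def algebra_simps)
qed

end

theory Submission
  imports Defs
begin

text \<open>
  The frame bounds follow from the triangle inequality in \<open>\<ell>\<^sup>2(J)\<close>, since by Cauchy-Schwarz the
  coefficient sequences of \<open>h\<close> with respect to \<open>x\<close> and \<open>y\<close> are at distance at most
  \<open>sqrt \<epsilon> * hnorm h\<close>.  One point needs care.  If \<open>A < \<epsilon>\<close>, which can happen because \<open>A\<close> need not
  be optimal, then \<open>A * (1 - sqrt (\<epsilon> / A))\<^sup>2 = (sqrt \<epsilon> - sqrt A)\<^sup>2\<close> is not what the triangle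
  inequality yields.  But phase retrieval for the pair \<open>h, 0\<close> shows that \<open>1 / C\<^sup>2\<close> is a lower frame
  bound of \<open>x\<close>, and if the space is nonzero then \<open>1 / C\<^sup>2 \<le> B\<close>, so \<open>16 * \<epsilon> < 1 / C\<^sup>2\<close>.  Hence
  \<open>max A (16 * \<epsilon>)\<close> is a lower frame bound too, and it leaves enough room to cover this case and to
  give a positive lower bound for \<open>y\<close>.

  For phase retrieval the difficulty is that the moduli of the coefficients of \<open>f\<close> and \<open>g\<close> move
  by about \<open>sqrt \<epsilon> * (hnorm f + hnorm g)\<close>, which can be far larger than the distance of \<open>f\<close> and
  \<open>g\<close> modulo phase.  The remedy is to replace \<open>f, g\<close> by an orthogonal pair.  Choose the phase of
  \<open>g\<close> such that \<open>ip f g \<ge> 0\<close>; then \<open>u = f - g\<close> realizes the distance and \<open>v = f + g\<close> is at least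
  as long as \<open>u\<close>.  Shrink \<open>v\<close> to \<open>t v\<close> of the same length as \<open>u\<close> and put \<open>f' = (t v + u) / 2\<close>,
  \<open>g' = (t v - u) / 2\<close>.  These vectors are orthogonal, so their distance modulo phase is
  \<open>sqrt ((hnorm f')\<^sup>2 + (hnorm g')\<^sup>2) = hnorm u\<close>, and shrinking \<open>v\<close> does not increase any
  difference of moduli (lemma \<open>modulus_difference_contraction\<close>).  So stability need only be
  verified for orthogonal pairs (lemma \<open>stability_from_orthogonal_pairs\<close>).  For these, the sum of
  the squared differences of moduli changes by at most \<open>4 * sqrt (\<epsilon> * B)\<close> times the squared
  distance (lemma \<open>modulus_difference_perturb\<close>), and \<open>1 / C\<^sup>2\<close> is thereby replaced by
  \<open>1 / C\<^sup>2 - 4 * sqrt (\<epsilon> * B)\<close>.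
\<close>

section \<open>Scalars and moduli\<close>

lemma conj_diff: "conj (z - w :: 'k::rc_scalar) = conj z - conj w"
  using conj_add[of "z - w" w] by (simp add: algebra_simps)

lemma re_of_real: "re (of_real r :: 'k::rc_scalar) = r"
proof -
  have "(of_real (2 * re (of_real r :: 'k)) :: 'k) = of_real (2 * r)"
    using add_conj[of "of_real r :: 'k"] by (simp add: conj_of_real)
  then show ?thesis by (simp only: of_real_eq_iff)
qed

lemma conj_conj: "conj (conj z) = (z :: 'k::rc_scalar)"
proof -
  have "conj (z + conj z) = z + conj z"
    unfolding add_conj by (rule conj_of_real)
  then show ?thesis by (simp add: conj_add add.commute)
qed

lemma norm_real_combination:
  "(norm (of_real r * a + of_real s * b :: 'k::rc_scalar))\<^sup>2
     = r\<^sup>2 * (norm a)\<^sup>2 + s\<^sup>2 * (norm b)\<^sup>2 + 2 * r * s * re (a * conj b)"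
proof -
  have cross: "b * conj a = conj (a * conj b)"
    by (simp add: conj_mult conj_conj mult.commute)
  have "(of_real ((norm (of_real r * a + of_real s * b))\<^sup>2) :: 'k)
      = of_real (r\<^sup>2) * (a * conj a) + of_real (s\<^sup>2) * (b * conj b)
        + of_real (r * s) * (a * conj b + b * conj a)"
    unfolding mult_conj[symmetric]
    by (simp add: conj_add conj_mult conj_of_real algebra_simps power2_eq_square)
  also have "\<dots> = of_real (r\<^sup>2 * (norm a)\<^sup>2 + s\<^sup>2 * (norm b)\<^sup>2 + 2 * r * s * re (a * conj b))"
    unfolding cross add_conj mult_conj by simp
  finally show ?thesis by (simp only: of_real_eq_iff)
qed

lemma norm_conj: "norm (conj z :: 'k::rc_scalar) = norm z"
proof -
  have "(of_real ((norm (conj z))\<^sup>2) :: 'k) = of_real ((norm z)\<^sup>2)"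
    using mult_conj[of z] mult_conj[of "conj z"] by (simp add: conj_conj mult.commute)
  then show ?thesis by (simp only: of_real_eq_iff) simp
qed

text \<open>
  With \<open>u = a - b\<close> and \<open>v = a + b\<close>, the two combinations are \<open>(t v + u) / 2\<close> and \<open>(t v - u) / 2\<close>:
  the difference of \<open>a\<close> and \<open>b\<close> is kept and their sum is shrunk by the factor \<open>t\<close>.  If \<open>p\<close> and \<open>q\<close>
  are the new moduli, then \<open>p\<^sup>2 - q\<^sup>2 = t * (\<bar>a\<bar>\<^sup>2 - \<bar>b\<bar>\<^sup>2)\<close>, so it suffices that
  \<open>t * (\<bar>a\<bar> + \<bar>b\<bar>) \<le> p + q\<close>.  Inverting the linear map, which has determinant \<open>t\<close>, and using the
  triangle inequality gives this, because \<open>\<alpha> + \<bar>\<beta>\<bar> = 1\<close>.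
\<close>

lemma modulus_difference_contraction:
  fixes a b :: "'k::rc_scalar"
  assumes t: "0 \<le> t" "t \<le> 1"
  defines "\<alpha> \<equiv> (t + 1) / 2" and "\<beta> \<equiv> (t - 1) / 2"
  shows "\<bar>norm (of_real \<alpha> * a + of_real \<beta> * b) - norm (of_real \<beta> * a + of_real \<alpha> * b)\<bar>
           \<le> \<bar>norm a - norm b\<bar>"
proof -
  define p where "p = norm (of_real \<alpha> * a + of_real \<beta> * b)"
  define q where "q = norm (of_real \<beta> * a + of_real \<alpha> * b)"
  have \<alpha>0: "0 \<le> \<alpha>" and \<beta>0: "\<beta> \<le> 0" and sum1: "\<alpha> - \<beta> = 1" and t_eq: "\<alpha>\<^sup>2 - \<beta>\<^sup>2 = t"
    using t by (auto simp: \<alpha>_def \<beta>_def power2_eq_square field_simps)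
  have pq0: "0 \<le> p" "0 \<le> q" by (simp_all add: p_def q_def)
  have prod_eq: "(p - q) * (p + q) = t * ((norm a - norm b) * (norm a + norm b))"
  proof -
    have "(p - q) * (p + q) = p\<^sup>2 - q\<^sup>2" by (simp add: power2_eq_square algebra_simps)
    also have "\<dots> = (\<alpha>\<^sup>2 - \<beta>\<^sup>2) * ((norm a)\<^sup>2 - (norm b)\<^sup>2)"
      unfolding p_def q_def norm_real_combination by (simp add: algebra_simps)
    finally show ?thesis unfolding t_eq by (simp add: power2_eq_square algebra_simps)
  qed
  have ta: "t * norm a \<le> \<alpha> * p - \<beta> * q"
  proof -
    have "of_real t * a = of_real \<alpha> * (of_real \<alpha> * a + of_real \<beta> * b)
        - of_real \<beta> * (of_real \<beta> * a + of_real \<alpha> * b)"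
      unfolding t_eq[symmetric] by (simp add: algebra_simps power2_eq_square)
    then have "norm (of_real t * a) \<le> norm (of_real \<alpha> * (of_real \<alpha> * a + of_real \<beta> * b))
        + norm (of_real \<beta> * (of_real \<beta> * a + of_real \<alpha> * b))"
      by (metis norm_triangle_ineq4)
    then show ?thesis using t \<alpha>0 \<beta>0 by (simp add: norm_mult p_def q_def)
  qed
  have tb: "t * norm b \<le> \<alpha> * q - \<beta> * p"
  proof -
    have "of_real t * b = of_real \<alpha> * (of_real \<beta> * a + of_real \<alpha> * b)
        - of_real \<beta> * (of_real \<alpha> * a + of_real \<beta> * b)"
      unfolding t_eq[symmetric] by (simp add: algebra_simps power2_eq_square)
    then have "norm (of_real t * b) \<le> norm (of_real \<alpha> * (of_real \<beta> * a + of_real \<alpha> * b))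
        + norm (of_real \<beta> * (of_real \<alpha> * a + of_real \<beta> * b))"
      by (metis norm_triangle_ineq4)
    then show ?thesis using t \<alpha>0 \<beta>0 by (simp add: norm_mult p_def q_def)
  qed
  have "t * (norm a + norm b) \<le> (\<alpha> - \<beta>) * (p + q)"
    using ta tb by (simp add: algebra_simps)
  then have le: "t * (norm a + norm b) \<le> p + q" by (simp add: sum1)
  show ?thesis
  proof (cases "p + q = 0")
    case True
    then have "p = 0" "q = 0" using pq0 by auto
    then show ?thesis unfolding p_def[symmetric] q_def[symmetric] by simp
  next
    case False
    then have pos: "0 < p + q" using pq0 by simp
    have "\<bar>p - q\<bar> * (p + q) = \<bar>(p - q) * (p + q)\<bar>"
      using pos by (simp add: abs_mult)
    also have "\<dots> = \<bar>norm a - norm b\<bar> * (t * (norm a + norm b))"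
      unfolding prod_eq using t by (simp add: abs_mult)
    also have "\<dots> \<le> \<bar>norm a - norm b\<bar> * (p + q)"
      by (rule mult_left_mono[OF le]) simp
    finally show ?thesis
      using pos unfolding p_def[symmetric] q_def[symmetric] by simp
  qed
qed

text \<open>
  Summed over an index set and with the right weight \<open>s\<close>, this takes the place of the
  Cauchy-Schwarz inequality in \<open>\<ell>\<^sup>2\<close>; the weight will be the square root of a quotient of the two
  bounds on the sums.
\<close>

lemma two_mult_le_weighted:
  fixes a b s :: real
  assumes "0 < s"
  shows "2 * a * b \<le> s * a\<^sup>2 + b\<^sup>2 / s"
proof -
  have "0 \<le> (s * a - b)\<^sup>2 / s" using assms by simp
  also have "\<dots> = s * a\<^sup>2 + b\<^sup>2 / s - 2 * a * b"
    using assms by (simp add: field_simps power2_eq_square)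
  finally show ?thesis by simp
qed

lemma abs_diff_square_le:
  fixes p q :: real
  assumes "0 \<le> p" "0 \<le> q"
  shows "\<bar>p - q\<bar>\<^sup>2 \<le> p\<^sup>2 + q\<^sup>2"
  using assms by (simp add: power2_diff)

section \<open>Inner products and optimal phases\<close>

context fd_hilbert_space
begin

lemma ip_diff_left: "ip (x - y) z = ip x z - ip y z"
  using ip_add_left[of "x - y" y z] by (simp add: algebra_simps)

lemma ip_add_right: "ip x (y + z) = ip x y + ip x z"
  by (subst (1 2 3) ip_commute) (simp add: ip_add_left conj_add)

lemma ip_diff_right: "ip x (y - z) = ip x y - ip x z"
  by (subst (1 2 3) ip_commute) (simp add: ip_diff_left conj_diff)

lemma ip_scale_right: "ip x (scale a y) = conj a * ip x y"
  by (subst (1 2) ip_commute) (simp add: ip_scale_left conj_mult)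

lemma ip_zero_left: "ip 0 z = 0"
  using ip_diff_left[of 0 0 z] by simp

lemma re_ip_self_nonneg: "0 \<le> re (ip h h)"
  using ip_pos[of h] re_of_real[of 0, where ?'k = 'k] by (cases "h = 0") (auto simp: ip_zero_left)

lemma hnorm_nonneg: "0 \<le> hnorm h"
  by (simp add: hnorm_def re_ip_self_nonneg)

lemma hnorm_square: "(hnorm h)\<^sup>2 = re (ip h h)"
  by (simp add: hnorm_def re_ip_self_nonneg)

lemma hnorm_zero: "hnorm 0 = 0"
  using re_of_real[of 0, where ?'k = 'k] by (simp add: hnorm_def ip_zero_left)

lemma hnorm_pos: "h \<noteq> 0 \<Longrightarrow> 0 < hnorm h"
  by (simp add: hnorm_def ip_pos)

lemma ip_self: "ip h h = of_real ((hnorm h)\<^sup>2)"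
proof -
  have "conj (ip h h) = ip h h" by (rule ip_commute[symmetric])
  then show ?thesis using add_conj[of "ip h h"] by (simp add: hnorm_square)
qed

lemma hnorm_square_real_combination:
  assumes c: "ip f g = of_real c"
  shows "(hnorm (scale (of_real r) f + scale (of_real s) g))\<^sup>2
    = r\<^sup>2 * (hnorm f)\<^sup>2 + s\<^sup>2 * (hnorm g)\<^sup>2 + 2 * r * s * c"
proof -
  have c': "ip g f = of_real c"
    by (subst ip_commute) (simp add: c conj_of_real)
  have "ip (scale (of_real r) f + scale (of_real s) g) (scale (of_real r) f + scale (of_real s) g)
     = of_real (r\<^sup>2 * (hnorm f)\<^sup>2 + s\<^sup>2 * (hnorm g)\<^sup>2 + 2 * r * s * c)"
    by (simp add: ip_add_left ip_add_right ip_scale_left ip_scale_right conj_of_real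
        ip_self[of f] ip_self[of g] c c' algebra_simps power2_eq_square)
  then show ?thesis unfolding ip_self by (simp only: of_real_eq_iff)
qed

text \<open>
  The usual argument: \<open>w\<close> below is a multiple of the component of \<open>f\<close> orthogonal to \<open>g\<close>, scaled
  to avoid division, and \<open>(hnorm w)\<^sup>2 \<ge> 0\<close> is the claim.
\<close>

lemma Cauchy_Schwarz_ip: "norm (ip f g) \<le> hnorm f * hnorm g"
proof (cases "g = 0")
  case True
  then show ?thesis
    by (subst ip_commute) (simp add: ip_zero_left hnorm_zero norm_conj)
next
  case False
  define n where "n = (hnorm g)\<^sup>2"
  define c where "c = ip f g"
  have n: "0 < n" using hnorm_pos[OF False] by (simp add: n_def)
  have gf: "ip g f = conj c" unfolding c_def by (rule ip_commute)
  define w where "w = scale (of_real n) f - scale c g"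
  have "ip w w = of_real (n\<^sup>2 * (hnorm f)\<^sup>2) - of_real n * (c * conj c)"
    by (simp add: w_def ip_diff_left ip_diff_right ip_scale_left ip_scale_right conj_of_real gf
        ip_self[of f] ip_self[of g, folded n_def] flip: c_def) (simp add: algebra_simps power2_eq_square)
  also have "\<dots> = of_real (n * (n * (hnorm f)\<^sup>2 - (norm c)\<^sup>2))"
    unfolding mult_conj by (simp add: algebra_simps power2_eq_square)
  finally have "(hnorm w)\<^sup>2 = n * (n * (hnorm f)\<^sup>2 - (norm c)\<^sup>2)"
    unfolding ip_self by (simp only: of_real_eq_iff)
  then have "0 \<le> n * (n * (hnorm f)\<^sup>2 - (norm c)\<^sup>2)"
    by (metis zero_le_power2)
  then have "(norm c)\<^sup>2 \<le> n * (hnorm f)\<^sup>2"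
    using n by (simp add: zero_le_mult_iff)
  then have "(norm (ip f g))\<^sup>2 \<le> (hnorm f * hnorm g)\<^sup>2"
    by (simp add: c_def n_def power_mult_distrib mult.commute)
  then show ?thesis
    by (rule power2_le_imp_le) (simp add: hnorm_nonneg)
qed

lemma norm_ip_phase: "norm l = 1 \<Longrightarrow> norm (ip (scale l g) z) = norm (ip g z)"
  by (simp add: ip_scale_left norm_mult)

lemma aligning_phase:
  obtains l where "norm l = 1" "ip f (scale l g) = of_real (norm (ip f g))"
proof (cases "ip f g = 0")
  case True
  then show ?thesis using that[of 1] by (simp add: ip_scale_right)
next
  case False
  define c where "c = ip f g"
  define l where "l = of_real (inverse (norm c)) * c"
  have c: "c \<noteq> 0" using False by (simp add: c_def)
  have "norm l = 1" using c by (simp add: l_def norm_mult norm_inverse)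
  moreover have "ip f (scale l g) = of_real (inverse (norm c)) * (c * conj c)"
    by (simp add: ip_scale_right l_def conj_mult conj_of_real del: of_real_inverse flip: c_def)
  then have "ip f (scale l g) = of_real (norm c)"
    unfolding mult_conj using c by (simp add: power2_eq_square)
  ultimately show ?thesis using that by (simp add: c_def)
qed

lemma phase_infimum_le:
  assumes "norm l = 1"
  shows "(INF l\<in>{l::'k. norm l = 1}. hnorm (f - scale l g)) \<le> hnorm (f - scale l g)"
proof (rule cINF_lower)
  show "bdd_below ((\<lambda>l. hnorm (f - scale l g)) ` {l. norm l = 1})"
    by (rule bdd_belowI[of _ 0]) (auto simp: hnorm_nonneg)
qed (use assms in simp)

text \<open>
  By Pythagoras the distance does not depend on the phase.
\<close>

lemma phase_infimum_orthogonal: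
  assumes "ip f g = 0"
  shows "(INF l\<in>{l::'k. norm l = 1}. hnorm (f - scale l g)) = sqrt ((hnorm f)\<^sup>2 + (hnorm g)\<^sup>2)"
proof -
  have gf: "ip g f = 0"
    by (subst ip_commute) (use assms conj_of_real[of 0] in simp)
  have "hnorm (f - scale l g) = sqrt ((hnorm f)\<^sup>2 + (hnorm g)\<^sup>2)" if l: "norm l = 1" for l
  proof -
    have "ip (f - scale l g) (f - scale l g) = of_real ((hnorm f)\<^sup>2) + (l * conj l) * of_real ((hnorm g)\<^sup>2)"
      by (simp add: ip_diff_left ip_diff_right ip_scale_left ip_scale_right assms gf ip_self[of f] ip_self[of g])
    also have "\<dots> = of_real ((hnorm f)\<^sup>2 + (hnorm g)\<^sup>2)"
      unfolding mult_conj l by simp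
    finally have "(hnorm (f - scale l g))\<^sup>2 = (hnorm f)\<^sup>2 + (hnorm g)\<^sup>2"
      unfolding ip_self by (simp only: of_real_eq_iff)
    then show ?thesis using hnorm_nonneg real_sqrt_unique by metis
  qed
  then have "(\<lambda>l. hnorm (f - scale l g)) ` {l. norm l = 1} = {sqrt ((hnorm f)\<^sup>2 + (hnorm g)\<^sup>2)}"
    by (auto simp: image_iff intro!: exI[of _ 1])
  then show ?thesis by simp
qed

text \<open>
  The pair is obtained from \<open>f\<close> and the aligned \<open>g\<close> by equalizing the lengths of their difference
  and sum: two vectors with real inner product are orthogonal exactly when their sum and difference
  have equal length.  The difference is unchanged, which preserves the distance, and the third
  property is \<open>modulus_difference_contraction\<close> for the coefficients.
\<close>

lemma reduction_to_orthogonal_pair: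
  fixes f g :: 'h
  defines "D \<equiv> (INF l\<in>{l::'k. norm l = 1}. hnorm (f - scale l g))"
  obtains f' g' where
    "ip f' g' = 0"
    "D \<le> sqrt ((hnorm f')\<^sup>2 + (hnorm g')\<^sup>2)"
    "\<forall>z. \<bar>norm (ip f' z) - norm (ip g' z)\<bar> \<le> \<bar>norm (ip f z) - norm (ip g z)\<bar>"
proof -
  obtain l where l: "norm l = 1" "ip f (scale l g) = of_real (norm (ip f g))"
    by (rule aligning_phase)
  define g1 where "g1 = scale l g"
  define c where "c = norm (ip f g)"
  have fg1: "ip f g1 = of_real c" using l by (simp add: g1_def c_def)
  have c0: "0 \<le> c" by (simp add: c_def)
  define S where "S = (hnorm f)\<^sup>2 + (hnorm g)\<^sup>2"
  have ng1: "(hnorm g1)\<^sup>2 = (hnorm g)\<^sup>2"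
  proof -
    have "ip g1 g1 = (l * conj l) * ip g g"
      by (simp add: g1_def ip_scale_left ip_scale_right)
    also have "\<dots> = ip g g" unfolding mult_conj l by simp
    finally show ?thesis by (simp add: hnorm_square)
  qed
  have S: "S = (hnorm f)\<^sup>2 + (hnorm g1)\<^sup>2" by (simp add: S_def ng1)
  have u: "(hnorm (f - g1))\<^sup>2 = S - 2 * c"
    using hnorm_square_real_combination[OF fg1, of 1 "-1"] by (simp add: S)
  have v: "(hnorm (f + g1))\<^sup>2 = S + 2 * c"
    using hnorm_square_real_combination[OF fg1, of 1 1] by (simp add: S)
  have u0: "0 \<le> S - 2 * c" and v0: "0 \<le> S + 2 * c" using u v by (metis zero_le_power2)+
  \<comment> \<open>\<open>t\<close> is the ratio of the lengths of \<open>f - g1\<close> and \<open>f + g1\<close>.  If \<open>f + g1 = 0\<close> then, because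
    \<open>c \<ge> 0\<close>, both vectors vanish and any \<open>t\<close> in \<open>[0, 1]\<close> will do.\<close>
  define t where "t = (if S + 2 * c = 0 then 0 else sqrt ((S - 2 * c) / (S + 2 * c)))"
  have t0: "0 \<le> t" using u0 v0 by (simp add: t_def)
  have t1: "t \<le> 1" using u0 v0 c0 by (simp add: t_def)
  have tt: "t\<^sup>2 * (S + 2 * c) = S - 2 * c"
    using u0 v0 c0 by (auto simp: t_def)
  define \<alpha> where "\<alpha> = (t + 1) / 2"
  define \<beta> where "\<beta> = (t - 1) / 2"
  define f' where "f' = scale (of_real \<alpha>) f + scale (of_real \<beta>) g1"
  define g' where "g' = scale (of_real \<beta>) f + scale (of_real \<alpha>) g1"
  have g1f: "ip g1 f = of_real c" by (subst ip_commute) (simp add: fg1 conj_of_real)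
  \<comment> \<open>The inner product equals \<open>(t\<^sup>2 * (hnorm (f + g1))\<^sup>2 - (hnorm (f - g1))\<^sup>2) / 4\<close>, and \<open>t\<close> makes
    this zero.\<close>
  have "ip f' g' = of_real (\<alpha> * \<beta> * S + (\<alpha>\<^sup>2 + \<beta>\<^sup>2) * c)"
    by (simp add: f'_def g'_def ip_add_left ip_add_right ip_scale_left ip_scale_right
        conj_of_real fg1 g1f ip_self S algebra_simps power2_eq_square)
  also have "\<alpha> * \<beta> * S + (\<alpha>\<^sup>2 + \<beta>\<^sup>2) * c = (t\<^sup>2 * (S + 2 * c) - (S - 2 * c)) / 4"
    by (simp add: \<alpha>_def \<beta>_def field_simps power2_eq_square)
  also have "\<dots> = 0" by (simp add: tt)
  finally have orth: "ip f' g' = 0" by simp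
  have "(hnorm f')\<^sup>2 + (hnorm g')\<^sup>2 = (\<alpha>\<^sup>2 + \<beta>\<^sup>2) * S + 4 * \<alpha> * \<beta> * c"
    unfolding f'_def g'_def hnorm_square_real_combination[OF fg1] S by (simp add: algebra_simps)
  also have "\<dots> = (t\<^sup>2 * (S + 2 * c) + (S - 2 * c)) / 2"
    by (simp add: \<alpha>_def \<beta>_def field_simps power2_eq_square)
  also have "\<dots> = (hnorm (f - g1))\<^sup>2" by (simp add: tt u)
  finally have "sqrt ((hnorm f')\<^sup>2 + (hnorm g')\<^sup>2) = hnorm (f - g1)"
    by (simp add: hnorm_nonneg)
  then have "D \<le> sqrt ((hnorm f')\<^sup>2 + (hnorm g')\<^sup>2)"
    unfolding D_def using phase_infimum_le[OF l(1), of f g] by (simp add: g1_def)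
  moreover have "\<bar>norm (ip f' z) - norm (ip g' z)\<bar> \<le> \<bar>norm (ip f z) - norm (ip g z)\<bar>" for z
    using modulus_difference_contraction[OF t0 t1, of "ip f z" "ip g1 z", folded \<alpha>_def \<beta>_def]
      norm_ip_phase[OF l(1), of g z, folded g1_def]
    by (simp add: f'_def g'_def ip_add_left ip_scale_left)
  ultimately show ?thesis using orth that by blast
qed

section \<open>Perturbation of frames\<close>

lemma norm_ip_square_le: "(norm (ip h z))\<^sup>2 \<le> (hnorm h)\<^sup>2 * (hnorm z)\<^sup>2"
  using power_mono[OF Cauchy_Schwarz_ip[of h z], of 2] by (simp add: power_mult_distrib)

lemma norm_ip_perturb: "\<bar>norm (ip h x) - norm (ip h y)\<bar> \<le> norm (ip h (x - y))"
  by (simp add: ip_diff_right norm_triangle_ineq3)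

text \<open>
  The weight \<open>s = sqrt (\<epsilon> / B)\<close> is the one for which the two terms of the weighted inequality
  combine to a perfect square.
\<close>

lemma frame_upper_perturb:
  assumes x: "\<And>h. (\<lambda>j. (norm (ip h (x j)))\<^sup>2) summable_on J"
      "\<And>h. (\<Sum>\<^sub>\<infinity>j\<in>J. (norm (ip h (x j)))\<^sup>2) \<le> B * (hnorm h)\<^sup>2"
    and B: "0 < B" and \<epsilon>: "0 < \<epsilon>"
    and z: "(\<lambda>j. (hnorm (x j - y j))\<^sup>2) summable_on J"
      "(\<Sum>\<^sub>\<infinity>j\<in>J. (hnorm (x j - y j))\<^sup>2) \<le> \<epsilon>"
  shows "(\<lambda>j. (norm (ip h (y j)))\<^sup>2) summable_on J"
    and "(\<Sum>\<^sub>\<infinity>j\<in>J. (norm (ip h (y j)))\<^sup>2) \<le> B * (1 + sqrt (\<epsilon> / B))\<^sup>2 * (hnorm h)\<^sup>2"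
proof -
  define s where "s = sqrt (\<epsilon> / B)"
  have s: "0 < s" using B \<epsilon> by (simp add: s_def)
  have s2: "\<epsilon> = s\<^sup>2 * B" using B \<epsilon> by (simp add: s_def)
  define k where "k = (1 + 1 / s) * (hnorm h)\<^sup>2"
  have k: "0 \<le> k" using s by (simp add: k_def)
  have le: "(norm (ip h (y j)))\<^sup>2 \<le> (1 + s) * (norm (ip h (x j)))\<^sup>2 + k * (hnorm (x j - y j))\<^sup>2" for j
  proof -
    let ?a = "norm (ip h (x j))" and ?b = "norm (ip h (x j - y j))"
    have "norm (ip h (y j)) \<le> ?a + ?b" using norm_ip_perturb[of h "x j" "y j"] by linarith
    then have "(norm (ip h (y j)))\<^sup>2 \<le> (?a + ?b)\<^sup>2" by (rule power_mono) simp
    also have "\<dots> \<le> (1 + s) * ?a\<^sup>2 + (1 + 1 / s) * ?b\<^sup>2"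
      using two_mult_le_weighted[OF s, of ?a ?b] by (simp add: power2_sum algebra_simps)
    also have "\<dots> \<le> (1 + s) * ?a\<^sup>2 + (1 + 1 / s) * ((hnorm h)\<^sup>2 * (hnorm (x j - y j))\<^sup>2)"
      using s by (intro add_left_mono mult_left_mono norm_ip_square_le) simp
    finally show ?thesis by (simp add: k_def)
  qed
  have sum: "(\<lambda>j. (1 + s) * (norm (ip h (x j)))\<^sup>2 + k * (hnorm (x j - y j))\<^sup>2) summable_on J"
    by (intro summable_on_add summable_on_cmult_right x z)
  show sy: "(\<lambda>j. (norm (ip h (y j)))\<^sup>2) summable_on J"
    by (rule summable_on_comparison_test[OF sum]) (use le in auto)
  have "(\<Sum>\<^sub>\<infinity>j\<in>J. (norm (ip h (y j)))\<^sup>2)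
     \<le> (\<Sum>\<^sub>\<infinity>j\<in>J. (1 + s) * (norm (ip h (x j)))\<^sup>2 + k * (hnorm (x j - y j))\<^sup>2)"
    by (rule infsum_mono[OF sy sum le])
  also have "\<dots> = (1 + s) * (\<Sum>\<^sub>\<infinity>j\<in>J. (norm (ip h (x j)))\<^sup>2) + k * (\<Sum>\<^sub>\<infinity>j\<in>J. (hnorm (x j - y j))\<^sup>2)"
    by (simp add: infsum_add infsum_cmult_right summable_on_cmult_right x z)
  also have "\<dots> \<le> (1 + s) * (B * (hnorm h)\<^sup>2) + k * \<epsilon>"
    using s k by (intro add_mono mult_left_mono x z) auto
  also have "\<dots> = B * (1 + s)\<^sup>2 * (hnorm h)\<^sup>2"
    using s by (simp add: k_def s2 field_simps power2_eq_square)
  finally show "(\<Sum>\<^sub>\<infinity>j\<in>J. (norm (ip h (y j)))\<^sup>2) \<le> B * (1 + sqrt (\<epsilon> / B))\<^sup>2 * (hnorm h)\<^sup>2"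
    by (simp add: s_def)
qed

text \<open>
  Only a single vector \<open>h\<close> is involved, with \<open>A\<close> any constant valid for it.  The condition
  \<open>\<epsilon> \<le> A\<close> keeps both weights \<open>1 - s\<close> and \<open>1 / s - 1\<close> nonnegative.
\<close>

lemma frame_lower_perturb:
  assumes x: "(\<lambda>j. (norm (ip h (x j)))\<^sup>2) summable_on J"
      "A * (hnorm h)\<^sup>2 \<le> (\<Sum>\<^sub>\<infinity>j\<in>J. (norm (ip h (x j)))\<^sup>2)"
    and y: "(\<lambda>j. (norm (ip h (y j)))\<^sup>2) summable_on J"
    and \<epsilon>: "0 < \<epsilon>" "\<epsilon> \<le> A"
    and z: "(\<lambda>j. (hnorm (x j - y j))\<^sup>2) summable_on J"
      "(\<Sum>\<^sub>\<infinity>j\<in>J. (hnorm (x j - y j))\<^sup>2) \<le> \<epsilon>"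
  shows "(sqrt A - sqrt \<epsilon>)\<^sup>2 * (hnorm h)\<^sup>2 \<le> (\<Sum>\<^sub>\<infinity>j\<in>J. (norm (ip h (y j)))\<^sup>2)"
proof -
  define s where "s = sqrt (\<epsilon> / A)"
  have A: "0 < A" using \<epsilon> by simp
  have s: "0 < s" "s \<le> 1" using A \<epsilon> by (simp_all add: s_def)
  have s2: "\<epsilon> = s\<^sup>2 * A" using A \<epsilon> by (simp add: s_def)
  define k where "k = (1 / s - 1) * (hnorm h)\<^sup>2"
  have k: "0 \<le> k" using s by (simp add: k_def)
  have le: "(1 - s) * (norm (ip h (x j)))\<^sup>2 \<le> (norm (ip h (y j)))\<^sup>2 + k * (hnorm (x j - y j))\<^sup>2" for j
  proof -
    let ?a = "norm (ip h (x j))" and ?b = "norm (ip h (x j - y j))" and ?c = "norm (ip h (y j))"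
    have "\<bar>?a - ?b\<bar> \<le> ?c" using norm_ip_perturb[of h "x j" "x j - y j"] by simp
    then have "\<bar>?a - ?b\<bar>\<^sup>2 \<le> ?c\<^sup>2" by (rule power_mono) simp
    then have "(1 - s) * ?a\<^sup>2 \<le> ?c\<^sup>2 + (1 / s - 1) * ?b\<^sup>2"
      using two_mult_le_weighted[OF s(1), of ?a ?b] by (simp add: power2_diff algebra_simps)
    also have "\<dots> \<le> ?c\<^sup>2 + (1 / s - 1) * ((hnorm h)\<^sup>2 * (hnorm (x j - y j))\<^sup>2)"
      using s by (intro add_left_mono mult_left_mono norm_ip_square_le) simp
    finally show ?thesis by (simp add: k_def)
  qed
  have "(1 - s) * (A * (hnorm h)\<^sup>2) \<le> (1 - s) * (\<Sum>\<^sub>\<infinity>j\<in>J. (norm (ip h (x j)))\<^sup>2)"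
    using s by (intro mult_left_mono x) simp
  also have "\<dots> = (\<Sum>\<^sub>\<infinity>j\<in>J. (1 - s) * (norm (ip h (x j)))\<^sup>2)"
    by (simp add: infsum_cmult_right x)
  also have "\<dots> \<le> (\<Sum>\<^sub>\<infinity>j\<in>J. (norm (ip h (y j)))\<^sup>2 + k * (hnorm (x j - y j))\<^sup>2)"
    by (intro infsum_mono le summable_on_add summable_on_cmult_right x y z)
  also have "\<dots> = (\<Sum>\<^sub>\<infinity>j\<in>J. (norm (ip h (y j)))\<^sup>2) + k * (\<Sum>\<^sub>\<infinity>j\<in>J. (hnorm (x j - y j))\<^sup>2)"
    by (simp add: infsum_add infsum_cmult_right summable_on_cmult_right y z)
  also have "\<dots> \<le> (\<Sum>\<^sub>\<infinity>j\<in>J. (norm (ip h (y j)))\<^sup>2) + k * \<epsilon>"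
    using k by (intro add_left_mono mult_left_mono z)
  finally have "(1 - s) * (A * (hnorm h)\<^sup>2) - k * \<epsilon> \<le> (\<Sum>\<^sub>\<infinity>j\<in>J. (norm (ip h (y j)))\<^sup>2)" by simp
  moreover have "(1 - s) * (A * (hnorm h)\<^sup>2) - k * \<epsilon> = A * (1 - s)\<^sup>2 * (hnorm h)\<^sup>2"
    using s by (simp add: k_def s2 field_simps power2_eq_square)
  moreover have "A * (1 - s)\<^sup>2 = (sqrt A - sqrt \<epsilon>)\<^sup>2"
    using A \<epsilon> by (simp add: s_def real_sqrt_divide power2_eq_square field_simps)
  ultimately show ?thesis by simp
qed

section \<open>Stability of phase retrieval\<close>

text \<open>
  Phase retrieval is applied to the pair \<open>h, 0\<close>, whose distance modulo phase is \<open>hnorm h\<close>.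
\<close>

lemma stable_phase_retrieval_lower_frame_bound:
  assumes "stable_phase_retrieval C J x"
  shows "(hnorm h)\<^sup>2 \<le> C\<^sup>2 * (\<Sum>\<^sub>\<infinity>j\<in>J. (norm (ip h (x j)))\<^sup>2)"
proof -
  have C: "0 < C" and *: "(INF l\<in>{l::'k. norm l = 1}. hnorm (h - scale l 0))
      \<le> C * sqrt (\<Sum>\<^sub>\<infinity>j\<in>J. \<bar>norm (ip h (x j)) - norm (ip 0 (x j))\<bar>\<^sup>2)"
    using assms unfolding stable_phase_retrieval_def by blast+
  have "ip h 0 = 0"
    by (subst ip_commute) (use conj_of_real[of 0] in \<open>simp add: ip_zero_left\<close>)
  then have "hnorm h \<le> C * sqrt (\<Sum>\<^sub>\<infinity>j\<in>J. (norm (ip h (x j)))\<^sup>2)"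
    using * phase_infimum_orthogonal[of h 0]
    by (simp add: ip_zero_left hnorm_zero hnorm_nonneg)
  from power_mono[OF this hnorm_nonneg, of 2] show ?thesis
    by (simp add: power_mult_distrib infsum_nonneg)
qed

lemma modulus_difference_summable:
  assumes "\<And>h. (\<lambda>j. (norm (ip h (x j)))\<^sup>2) summable_on J"
  shows "(\<lambda>j. \<bar>norm (ip f (x j)) - norm (ip g (x j))\<bar>\<^sup>2) summable_on J"
  by (rule summable_on_comparison_test[OF summable_on_add[OF assms[of f] assms[of g]]])
    (use abs_diff_square_le in auto)

text \<open>
  The error is measured by \<open>(hnorm f)\<^sup>2 + (hnorm g)\<^sup>2\<close>, which for orthogonal \<open>f\<close> and \<open>g\<close> is the
  square of their distance modulo phase.  Let \<open>X\<close> and \<open>Y\<close> be the sequences of differences of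
  moduli with respect to \<open>x\<close> and \<open>y\<close>, and \<open>N\<close> the square just named.  Then \<open>X\<close> has squared norm at
  most \<open>B * N\<close>, and \<open>X - Y\<close> has norm at most \<open>(hnorm f + hnorm g) * sqrt \<epsilon> \<le> 2 * sqrt (N * \<epsilon>)\<close>.
  So \<open>X\<^sup>2 - Y\<^sup>2 \<le> 2 * X * (X - Y)\<close> sums to at most \<open>4 * sqrt (\<epsilon> * B) * N\<close>.
\<close>

lemma modulus_difference_perturb:
  fixes f g :: 'h
  assumes x: "\<And>h. (\<lambda>j. (norm (ip h (x j)))\<^sup>2) summable_on J"
      "\<And>h. (\<Sum>\<^sub>\<infinity>j\<in>J. (norm (ip h (x j)))\<^sup>2) \<le> B * (hnorm h)\<^sup>2"
    and y: "\<And>h. (\<lambda>j. (norm (ip h (y j)))\<^sup>2) summable_on J"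
    and B: "0 < B" and \<epsilon>: "0 < \<epsilon>"
    and z: "(\<lambda>j. (hnorm (x j - y j))\<^sup>2) summable_on J"
      "(\<Sum>\<^sub>\<infinity>j\<in>J. (hnorm (x j - y j))\<^sup>2) \<le> \<epsilon>"
  defines "M w \<equiv> (\<Sum>\<^sub>\<infinity>j\<in>J. \<bar>norm (ip f (w j)) - norm (ip g (w j))\<bar>\<^sup>2)"
  shows "M x \<le> M y + 4 * sqrt (\<epsilon> * B) * ((hnorm f)\<^sup>2 + (hnorm g)\<^sup>2)"
proof -
  define N where "N = (hnorm f)\<^sup>2 + (hnorm g)\<^sup>2"
  have N: "0 \<le> N" by (simp add: N_def)
  define s where "s = sqrt (\<epsilon> / B)"
  have s: "0 < s" using B \<epsilon> by (simp add: s_def)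
  define X where "X j = \<bar>norm (ip f (x j)) - norm (ip g (x j))\<bar>" for j
  define Y where "Y j = \<bar>norm (ip f (y j)) - norm (ip g (y j))\<bar>" for j
  have SX: "(\<lambda>j. (X j)\<^sup>2) summable_on J" and SY: "(\<lambda>j. (Y j)\<^sup>2) summable_on J"
    unfolding X_def Y_def by (intro modulus_difference_summable x y)+
  have le: "(X j)\<^sup>2 \<le> (Y j)\<^sup>2 + (2 * s * (X j)\<^sup>2 + 2 * N / s * (hnorm (x j - y j))\<^sup>2)" for j
  proof -
    define d where "d = hnorm (x j - y j)"
    define e where "e = (hnorm f + hnorm g) * d"
    have d0: "0 \<le> d" by (simp add: d_def hnorm_nonneg)
    have e0: "0 \<le> e" by (simp add: e_def d0 hnorm_nonneg)
    have XY0: "0 \<le> X j" "0 \<le> Y j" by (simp_all add: X_def Y_def)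
    have "X j \<le> Y j + norm (ip f (x j - y j)) + norm (ip g (x j - y j))"
      using norm_ip_perturb[of f "x j" "y j"] norm_ip_perturb[of g "x j" "y j"]
      unfolding X_def Y_def by linarith
    also have "\<dots> \<le> Y j + e"
      using Cauchy_Schwarz_ip[of f "x j - y j"] Cauchy_Schwarz_ip[of g "x j - y j"]
      by (simp add: e_def d_def algebra_simps)
    finally have XYe: "X j \<le> Y j + e" .
    have "(X j)\<^sup>2 \<le> (Y j)\<^sup>2 + 2 * X j * e"
    proof -
      have "X j * X j \<le> X j * (Y j + e)" using XYe XY0 by (intro mult_left_mono)
      moreover have "2 * (X j * Y j) \<le> (X j)\<^sup>2 + (Y j)\<^sup>2"
        using sum_squares_bound[of "X j" "Y j"] by simp
      ultimately show ?thesis by (simp add: power2_eq_square algebra_simps)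
    qed
    also have "2 * X j * e = 2 * X j * (2 * (e / 2))" by simp
    also have "\<dots> \<le> 2 * s * (X j)\<^sup>2 + 2 * ((e / 2)\<^sup>2 / s)"
      using two_mult_le_weighted[OF s, of "X j" "e / 2"] by simp
    also have "(e / 2)\<^sup>2 \<le> N * d\<^sup>2"
    proof -
      have "(hnorm f + hnorm g)\<^sup>2 \<le> 2 * N"
        using sum_squares_bound[of "hnorm f" "hnorm g"] by (simp add: N_def power2_sum)
      then have "(hnorm f + hnorm g)\<^sup>2 * d\<^sup>2 \<le> (4 * N) * d\<^sup>2"
        using N by (intro mult_right_mono) auto
      then show ?thesis by (simp add: e_def power_mult_distrib power_divide)
    qed
    finally show ?thesis using s by (simp add: d_def divide_right_mono)
  qed
  have SE: "(\<lambda>j. 2 * s * (X j)\<^sup>2) summable_on J"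
      "(\<lambda>j. 2 * N / s * (hnorm (x j - y j))\<^sup>2) summable_on J"
    by (intro summable_on_cmult_right SX z)+
  have SX_le: "(\<Sum>\<^sub>\<infinity>j\<in>J. (X j)\<^sup>2) \<le> B * N"
  proof -
    have "(X j)\<^sup>2 \<le> (norm (ip f (x j)))\<^sup>2 + (norm (ip g (x j)))\<^sup>2" for j
      unfolding X_def by (rule abs_diff_square_le) simp_all
    then have "(\<Sum>\<^sub>\<infinity>j\<in>J. (X j)\<^sup>2)
        \<le> (\<Sum>\<^sub>\<infinity>j\<in>J. (norm (ip f (x j)))\<^sup>2 + (norm (ip g (x j)))\<^sup>2)"
      by (intro infsum_mono SX summable_on_add x)
    also have "\<dots> = (\<Sum>\<^sub>\<infinity>j\<in>J. (norm (ip f (x j)))\<^sup>2) + (\<Sum>\<^sub>\<infinity>j\<in>J. (norm (ip g (x j)))\<^sup>2)"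
      by (intro infsum_add x)
    also have "\<dots> \<le> B * (hnorm f)\<^sup>2 + B * (hnorm g)\<^sup>2" by (intro add_mono x)
    finally show ?thesis by (simp add: N_def algebra_simps)
  qed
  have "M x = (\<Sum>\<^sub>\<infinity>j\<in>J. (X j)\<^sup>2)" by (simp add: M_def X_def)
  also have "\<dots> \<le> (\<Sum>\<^sub>\<infinity>j\<in>J. (Y j)\<^sup>2 + (2 * s * (X j)\<^sup>2 + 2 * N / s * (hnorm (x j - y j))\<^sup>2))"
    by (intro infsum_mono SX SY SE summable_on_add le)
  also have "\<dots> = M y + (2 * s * (\<Sum>\<^sub>\<infinity>j\<in>J. (X j)\<^sup>2) + 2 * N / s * (\<Sum>\<^sub>\<infinity>j\<in>J. (hnorm (x j - y j))\<^sup>2))"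
    unfolding infsum_add[OF SY summable_on_add[OF SE]] infsum_add[OF SE]
      infsum_cmult_right[OF SX] infsum_cmult_right[OF z(1)]
    by (simp add: M_def Y_def)
  also have "\<dots> \<le> M y + (2 * s * (B * N) + 2 * N / s * \<epsilon>)"
    using s N by (intro add_left_mono add_mono mult_left_mono SX_le z) auto
  also have "2 * s * (B * N) + 2 * N / s * \<epsilon> = 2 * N * (s * B + \<epsilon> / s)"
    by (simp add: algebra_simps)
  also have "s * B + \<epsilon> / s = 2 * sqrt (\<epsilon> * B)"
  proof -
    have "s * B = sqrt (\<epsilon> * B)" "\<epsilon> / s = sqrt (\<epsilon> * B)"
      using B \<epsilon> by (simp_all add: s_def real_sqrt_divide real_sqrt_mult real_div_sqrt field_simps)
    then show ?thesis by simp
  qed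
  finally show ?thesis unfolding N_def[symmetric] by (simp add: mult_ac)
qed

text \<open>
  Passing to the orthogonal pair does not decrease the left-hand side and does not increase any
  term of the sum on the right.
\<close>

lemma stability_from_orthogonal_pairs:
  assumes K: "0 \<le> K"
    and orthogonal: "\<And>f g. ip f g = 0 \<Longrightarrow>
      (hnorm f)\<^sup>2 + (hnorm g)\<^sup>2
        \<le> K * (\<Sum>\<^sub>\<infinity>j\<in>J. \<bar>norm (ip f (y j)) - norm (ip g (y j))\<bar>\<^sup>2)"
    and y: "\<And>h. (\<lambda>j. (norm (ip h (y j)))\<^sup>2) summable_on J"
  shows "(INF l\<in>{l::'k. norm l = 1}. hnorm (f - scale l g))
    \<le> sqrt K * sqrt (\<Sum>\<^sub>\<infinity>j\<in>J. \<bar>norm (ip f (y j)) - norm (ip g (y j))\<bar>\<^sup>2)" (is "?D \<le> _ * sqrt ?M")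
proof -
  obtain f' g' where o: "ip f' g' = 0"
    and D: "?D \<le> sqrt ((hnorm f')\<^sup>2 + (hnorm g')\<^sup>2)"
    and le: "\<forall>z. \<bar>norm (ip f' z) - norm (ip g' z)\<bar> \<le> \<bar>norm (ip f z) - norm (ip g z)\<bar>"
    by (rule reduction_to_orthogonal_pair[of f g])
  have "(\<Sum>\<^sub>\<infinity>j\<in>J. \<bar>norm (ip f' (y j)) - norm (ip g' (y j))\<bar>\<^sup>2) \<le> ?M"
    by (intro infsum_mono modulus_difference_summable y power_mono le[rule_format]) simp
  then have "K * (\<Sum>\<^sub>\<infinity>j\<in>J. \<bar>norm (ip f' (y j)) - norm (ip g' (y j))\<bar>\<^sup>2) \<le> K * ?M"
    by (rule mult_left_mono[OF _ K])
  then have "(hnorm f')\<^sup>2 + (hnorm g')\<^sup>2 \<le> K * ?M"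
    by (rule order_trans[OF orthogonal[OF o]])
  then have "sqrt ((hnorm f')\<^sup>2 + (hnorm g')\<^sup>2) \<le> sqrt (K * ?M)"
    by simp
  with D show ?thesis by (simp add: real_sqrt_mult)
qed

end

section \<open>Perturbation of frames that do stable phase retrieval\<close>

theorem theorem1p2:
  fixes scale :: "'k::rc_scalar \<Rightarrow> 'h::ab_group_add \<Rightarrow> 'h"
    and ip :: "'h \<Rightarrow> 'h \<Rightarrow> 'k"
    and J :: "'j set"
    and x y :: "'j \<Rightarrow> 'h"
    and A B C \<epsilon> :: real
  assumes H: "fd_hilbert_space scale ip"
    and "0 < A" and "A \<le> B"
    and "fd_hilbert_space.frame_inequality ip J x A B"
    and "fd_hilbert_space.stable_phase_retrieval scale ip C J x"
    and "0 < \<epsilon>" and "\<epsilon> < 2 powi (-4) * C powi (-4) * B powi (-1)"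
    and "(\<lambda>j. (fd_hilbert_space.hnorm ip (x j - y j))\<^sup>2) summable_on J"
    and "(\<Sum>\<^sub>\<infinity>j\<in>J. (fd_hilbert_space.hnorm ip (x j - y j))\<^sup>2) < \<epsilon>"
  shows "fd_hilbert_space.is_frame ip J y
       \<and> fd_hilbert_space.frame_inequality ip J y
           (A * (1 - sqrt (\<epsilon> / A))\<^sup>2) (B * (1 + sqrt (\<epsilon> / B))\<^sup>2)
       \<and> fd_hilbert_space.stable_phase_retrieval scale ip
           (C * (1 - 4 * C\<^sup>2 * sqrt (\<epsilon> * B)) powr (-1/2)) J y"
proof -
  interpret fd_hilbert_space scale ip by (rule H)
  note A = \<open>0 < A\<close> and \<epsilon> = \<open>0 < \<epsilon>\<close>
  have B: "0 < B" using A \<open>A \<le> B\<close> by simp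
  have frame: "frame_inequality J x A B" and spr: "stable_phase_retrieval C J x" by fact+
  have z: "(\<lambda>j. (hnorm (x j - y j))\<^sup>2) summable_on J"
      "(\<Sum>\<^sub>\<infinity>j\<in>J. (hnorm (x j - y j))\<^sup>2) \<le> \<epsilon>"
    using assms(8,9) by auto
  have C: "0 < C" using spr by (simp add: stable_phase_retrieval_def)
  have x: "(\<lambda>j. (norm (ip h (x j)))\<^sup>2) summable_on J"
      "A * (hnorm h)\<^sup>2 \<le> (\<Sum>\<^sub>\<infinity>j\<in>J. (norm (ip h (x j)))\<^sup>2)"
      "(\<Sum>\<^sub>\<infinity>j\<in>J. (norm (ip h (x j)))\<^sup>2) \<le> B * (hnorm h)\<^sup>2" for h
    using frame by (auto simp: frame_inequality_def)
  \<comment> \<open>The smallness of \<open>\<epsilon>\<close> enters twice: as \<open>small\<close> for the lower frame bound, and as \<open>small'\<close>, which says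
    that the new stability constant is finite.\<close>
  have small: "16 * \<epsilon> * C ^ 4 * B < 1"
    using assms(7) B C by (simp add: power_int_minus field_simps)
  have small': "4 * C\<^sup>2 * sqrt (\<epsilon> * B) < 1"
  proof -
    have "(4 * C\<^sup>2 * sqrt (\<epsilon> * B))\<^sup>2 = 16 * \<epsilon> * C ^ 4 * B"
      using B \<epsilon> by (simp add: power_mult_distrib)
    then have "(4 * C\<^sup>2 * sqrt (\<epsilon> * B))\<^sup>2 < 1\<^sup>2" using small by simp
    then show ?thesis by (rule power_less_imp_less_base) simp
  qed

  note y = frame_upper_perturb[OF x(1,3) B \<epsilon> z]

  \<comment> \<open>The given \<open>A\<close> may be smaller than \<open>\<epsilon>\<close>; stability of phase retrieval shows that \<open>16 * \<epsilon>\<close> is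
    also a lower frame bound.\<close>
  define A' where "A' = max A (16 * \<epsilon>)"
  have A': "A' * (hnorm h)\<^sup>2 \<le> (\<Sum>\<^sub>\<infinity>j\<in>J. (norm (ip h (x j)))\<^sup>2)" for h
  proof (cases "h = 0")
    case True
    then show ?thesis by (simp add: hnorm_zero infsum_nonneg)
  next
    case False
    let ?S = "\<Sum>\<^sub>\<infinity>j\<in>J. (norm (ip h (x j)))\<^sup>2"
    have pos: "0 < (hnorm h)\<^sup>2" using hnorm_pos[OF False] by simp
    have low: "(hnorm h)\<^sup>2 \<le> C\<^sup>2 * ?S"
      by (rule stable_phase_retrieval_lower_frame_bound[OF spr])
    also have "\<dots> \<le> C\<^sup>2 * (B * (hnorm h)\<^sup>2)" by (intro mult_left_mono x) simp
    finally have CB: "1 \<le> C\<^sup>2 * B" using pos by simp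
    have "16 * \<epsilon> * C\<^sup>2 * 1 \<le> 16 * \<epsilon> * C\<^sup>2 * (C\<^sup>2 * B)"
      using \<epsilon> by (intro mult_left_mono[OF CB]) simp
    also have "\<dots> = 16 * \<epsilon> * C ^ 4 * B" by (simp add: power4_eq_xxxx power2_eq_square)
    also have "\<dots> \<le> 1" using small by simp
    finally have "16 * \<epsilon> * C\<^sup>2 \<le> 1" by simp
    then have "16 * \<epsilon> * C\<^sup>2 * ?S \<le> 1 * ?S" by (intro mult_right_mono infsum_nonneg) auto
    moreover have "16 * \<epsilon> * (hnorm h)\<^sup>2 \<le> 16 * \<epsilon> * (C\<^sup>2 * ?S)"
      using \<epsilon> low by (intro mult_left_mono) auto
    ultimately have "16 * \<epsilon> * (hnorm h)\<^sup>2 \<le> ?S" by (simp add: mult.assoc)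
    then show ?thesis using x(2)[of h] by (simp add: A'_def max_def)
  qed
  have \<epsilon>A': "\<epsilon> \<le> A'" using \<epsilon> by (simp add: A'_def)
  define L where "L = (sqrt A' - sqrt \<epsilon>)\<^sup>2"
  have lower: "L * (hnorm h)\<^sup>2 \<le> (\<Sum>\<^sub>\<infinity>j\<in>J. (norm (ip h (y j)))\<^sup>2)" for h
    unfolding L_def by (rule frame_lower_perturb[OF x(1) A' y(1) \<epsilon> \<epsilon>A' z])
  have sqrtA': "4 * sqrt \<epsilon> \<le> sqrt A'"
  proof -
    have "4 * sqrt \<epsilon> = sqrt (16 * \<epsilon>)" by (simp add: real_sqrt_mult)
    also have "\<dots> \<le> sqrt A'" by (simp add: A'_def)
    finally show ?thesis .
  qed
  have L: "0 < L"
  proof -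
    have "0 < sqrt \<epsilon>" using \<epsilon> by simp
    then have "0 < sqrt A' - sqrt \<epsilon>" using sqrtA' by linarith
    then show ?thesis by (simp add: L_def)
  qed
  \<comment> \<open>For \<open>\<epsilon> \<le> A\<close> this is monotonicity.  For \<open>A < \<epsilon>\<close> it rests on
    \<open>sqrt \<epsilon> - sqrt A \<le> sqrt \<epsilon> \<le> sqrt A' - sqrt \<epsilon>\<close>.\<close>
  have AL: "A * (1 - sqrt (\<epsilon> / A))\<^sup>2 \<le> L"
  proof -
    have "A * (1 - sqrt (\<epsilon> / A))\<^sup>2 = (sqrt A - sqrt \<epsilon>)\<^sup>2"
      using A \<epsilon> by (simp add: real_sqrt_divide power2_eq_square field_simps)
    also have "\<dots> = \<bar>sqrt A - sqrt \<epsilon>\<bar>\<^sup>2" by simp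
    also have "\<dots> \<le> (sqrt A' - sqrt \<epsilon>)\<^sup>2"
    proof (rule power_mono)
      have "sqrt A \<le> sqrt A'" by (simp add: A'_def)
      moreover have "0 \<le> sqrt A" "0 \<le> sqrt \<epsilon>" using A \<epsilon> by simp_all
      ultimately show "\<bar>sqrt A - sqrt \<epsilon>\<bar> \<le> sqrt A' - sqrt \<epsilon>" using sqrtA' by linarith
    qed simp
    finally show ?thesis by (simp add: L_def)
  qed
  have ineq: "frame_inequality J y (A * (1 - sqrt (\<epsilon> / A))\<^sup>2) (B * (1 + sqrt (\<epsilon> / B))\<^sup>2)"
    unfolding frame_inequality_def
    using y lower mult_right_mono[OF AL zero_le_power2] by (blast intro: order_trans)
  \<comment> \<open>On the zero space \<open>L\<close> can exceed the other upper bound, so the maximum is taken.\<close>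
  define U where "U = max L (B * (1 + sqrt (\<epsilon> / B))\<^sup>2)"
  have "(\<Sum>\<^sub>\<infinity>j\<in>J. (norm (ip h (y j)))\<^sup>2) \<le> U * (hnorm h)\<^sup>2" for h
    by (rule order_trans[OF y(2)]) (simp add: U_def mult_right_mono)
  then have "frame_inequality J y L U"
    unfolding frame_inequality_def using y(1) lower by blast
  then have is_frame: "is_frame J y"
    unfolding is_frame_def using L by (intro exI[of _ L] exI[of _ U]) (simp add: U_def)

  define \<kappa> where "\<kappa> = 1 - 4 * C\<^sup>2 * sqrt (\<epsilon> * B)"
  have \<kappa>: "0 < \<kappa>" using small' by (simp add: \<kappa>_def)
  have orthogonal: "(hnorm f)\<^sup>2 + (hnorm g)\<^sup>2
      \<le> C\<^sup>2 / \<kappa> * (\<Sum>\<^sub>\<infinity>j\<in>J. \<bar>norm (ip f (y j)) - norm (ip g (y j))\<bar>\<^sup>2)"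
    if fg: "ip f g = 0" for f g
  proof -
    let ?M = "\<lambda>w. \<Sum>\<^sub>\<infinity>j\<in>J. \<bar>norm (ip f (w j)) - norm (ip g (w j))\<bar>\<^sup>2"
    let ?N = "(hnorm f)\<^sup>2 + (hnorm g)\<^sup>2"
    have "(INF l\<in>{l::'k. norm l = 1}. hnorm (f - scale l g)) \<le> C * sqrt (?M x)"
      using spr unfolding stable_phase_retrieval_def by blast
    then have "sqrt ?N \<le> C * sqrt (?M x)"
      unfolding phase_infimum_orthogonal[OF fg] .
    then have "(sqrt ?N)\<^sup>2 \<le> (C * sqrt (?M x))\<^sup>2"
      by (rule power_mono) simp
    then have "?N \<le> C\<^sup>2 * ?M x"
      by (simp add: power_mult_distrib infsum_nonneg)
    also have "\<dots> \<le> C\<^sup>2 * (?M y + 4 * sqrt (\<epsilon> * B) * ?N)"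
      by (intro mult_left_mono modulus_difference_perturb x y B \<epsilon> z) simp
    finally have "?N * \<kappa> \<le> C\<^sup>2 * ?M y" by (simp add: \<kappa>_def algebra_simps)
    then have "?N \<le> C\<^sup>2 * ?M y / \<kappa>" unfolding pos_le_divide_eq[OF \<kappa>] .
    then show ?thesis by simp
  qed
  have sqrt_K: "sqrt (C\<^sup>2 / \<kappa>) = C * \<kappa> powr (-1/2)"
  proof -
    have "\<kappa> powr (-1/2) = \<kappa> powr (- (1/2))" by simp
    also have "\<dots> = 1 / sqrt \<kappa>"
      using \<kappa> by (simp only: powr_minus_divide powr_half_sqrt less_imp_le)
    finally show ?thesis using C by (simp add: real_sqrt_divide)
  qed
  have "0 \<le> C\<^sup>2 / \<kappa>" using \<kappa> by simp
  note stability = stability_from_orthogonal_pairs[OF this orthogonal y(1), unfolded sqrt_K]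
  have "0 < C * \<kappa> powr (-1/2)" using C \<kappa> by simp
  then have "stable_phase_retrieval (C * \<kappa> powr (-1/2)) J y"
    unfolding stable_phase_retrieval_def using is_frame stability by blast
  then show ?thesis using is_frame ineq unfolding \<kappa>_def by blast
qed

end
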